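(* Let $q$ be a prime power, let $n \geq 2$ and $1 \leq d \leq n-1$ be integers, and let $\ell \geq 2$ be an integer. Let $S \subset \mathbb{F}_q^n$ be an $(n,d)$-BRK-type set of degree $\ell$ (as defined in the context). Then \[|S| \geq \binom{\lfloor\frac{q-1}{\ell}\rfloor + n}{n}.\]
   Context: $\mathbb{F}_q$ denotes the finite field with $q$ elements. For a homogeneous polynomial $h \in \mathbb{F}_q[x_1,\dots,x_d]$, let $\mathcal{P}_h \subset \mathbb{F}_q[x_1,\dots,x_d]$ be the set of all polynomials whose homogeneous part of highest degree equals $h$. A set $S \subset \mathbb{F}_q^n$ is an $(n,d)$-BRK-type set of degree $\ell$ if there exist homogeneous polynomials $h_1,\dots,h_{n-d} \in \mathbb{F}_q[x_1,\dots,x_d]$ of degree $\ell$ such that for every $\rho = (\rho_1,\dots,\rho_{n-d}) \in \mathbb{F}_q^{n-d}$ there exist $a_\rho \in \mathbb{F}_q^n$ and polynomials $g_{\rho,1},\dots,g_{\rho,n-d} \in \mathbb{F}_q[x_1,\dots,x_d]$ with $g_{\rho,i} \in \mathcal{P}_{h_i}$ for each $i$, such that \[\{a_\rho + (t, \rho_1 g_{\rho,1}(t), \dots, \rho_{n-d} g_{\rho,n-d}(t)) : t \in \mathbb{F}_q^d\} \subset S.\] *)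

theory Defs
  imports
    "Jordan_Normal_Form.Matrix"
    "HOL-Library.Cardinality"
    "HOL-Library.Poly_Mapping"
begin

text \<open>
  A multivariate polynomial is a finitely supported map from exponent vectors to coefficients;
  ring operations are those of \<^theory>\<open>HOL-Library.Poly_Mapping\<close>.
  The paper's variables x_1, ..., x_d are the indices 0, ..., d - 1.
  Points of the n-dimensional space over the finite field are the elements of
  \<^term>\<open>carrier_vec n\<close>.
\<close>

type_synonym 'a mpoly = "(nat \<Rightarrow>\<^sub>0 nat) \<Rightarrow>\<^sub>0 'a"

definition polys_in :: "nat \<Rightarrow> 'a::zero mpoly set" where
  "polys_in d = {p. \<forall>m \<in> Poly_Mapping.keys p. Poly_Mapping.keys m \<subseteq> {..<d}}"

definition monom_degree :: "(nat \<Rightarrow>\<^sub>0 nat) \<Rightarrow> nat" where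
  "monom_degree m = (\<Sum>i\<in>Poly_Mapping.keys m. Poly_Mapping.lookup m i)"

definition total_degree :: "'a::zero mpoly \<Rightarrow> nat" where
  "total_degree p = Max (insert 0 (monom_degree ` Poly_Mapping.keys p))"

definition eval_mpoly :: "'a::comm_semiring_1 mpoly \<Rightarrow> 'a vec \<Rightarrow> 'a" where
  "eval_mpoly p t =
     (\<Sum>m\<in>Poly_Mapping.keys p.
        Poly_Mapping.lookup p m * (\<Prod>i\<in>Poly_Mapping.keys m. (t $ i) ^ Poly_Mapping.lookup m i))"

definition homogeneous_part :: "nat \<Rightarrow> 'a::comm_monoid_add mpoly \<Rightarrow> 'a mpoly" where
  "homogeneous_part k p =
     (\<Sum>m\<in>{m \<in> Poly_Mapping.keys p. monom_degree m = k}.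
        Poly_Mapping.single m (Poly_Mapping.lookup p m))"

definition leading_form :: "'a::comm_monoid_add mpoly \<Rightarrow> 'a mpoly" where
  "leading_form p = homogeneous_part (total_degree p) p"

text \<open>
  Having degree \<open>l\<close> is meant to include being nonzero. With the zero polynomial admitted as a
  form, a single \<open>d\<close>-dimensional coordinate subspace would be a BRK-type set of every degree,
  and the lower bound would be false in general.
\<close>

definition homogeneous_of_degree :: "nat \<Rightarrow> 'a::zero mpoly \<Rightarrow> bool" where
  "homogeneous_of_degree l h \<longleftrightarrow> h \<noteq> 0 \<and> (\<forall>m \<in> Poly_Mapping.keys h. monom_degree m = l)"

definition polys_with_leading_form :: "nat \<Rightarrow> 'a::comm_monoid_add mpoly \<Rightarrow> 'a mpoly set" where
  "polys_with_leading_form d h = {g \<in> polys_in d. leading_form g = h}"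

definition BRK_type_set ::
    "nat \<Rightarrow> nat \<Rightarrow> nat \<Rightarrow> 'a::{finite, field} vec set \<Rightarrow> bool" where
  "BRK_type_set n d l S \<longleftrightarrow>
     S \<subseteq> carrier_vec n \<and>
     (\<exists>h :: nat \<Rightarrow> 'a mpoly.
        (\<forall>i<n - d. h i \<in> polys_in d \<and> homogeneous_of_degree l (h i)) \<and>
        (\<forall>\<rho> \<in> carrier_vec (n - d).
           \<exists>a \<in> carrier_vec n. \<exists>g :: nat \<Rightarrow> 'a mpoly.
             (\<forall>i<n - d. g i \<in> polys_with_leading_form d (h i)) \<and>
             {a + (t @\<^sub>v vec (n - d) (\<lambda>i. \<rho> $ i * eval_mpoly (g i) t)) | t. t \<in> carrier_vec d}
               \<subseteq> S))"

lemma lookup_homogeneous_part: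
  "Poly_Mapping.lookup (homogeneous_part k p) m =
     (if monom_degree m = k then Poly_Mapping.lookup p m else 0)"
  by (auto simp: homogeneous_part_def lookup_sum lookup_single when_def in_keys_iff)

end

theory Submission
  imports Defs "HOL-Computational_Algebra.Polynomial" "HOL-Library.FuncSet"
begin

text \<open>
  If \<open>S\<close> were smaller than the number of monomials of degree at most \<open>k = (q - 1) div l\<close> in \<open>n\<close>
  variables, some nonzero \<open>P\<close> of degree at most \<open>k\<close> would vanish on \<open>S\<close>. Its restriction to the
  graph with parameter \<open>\<rho>\<close> is a polynomial in \<open>t\<close> of degree at most \<open>k * l \<le> q - 1\<close> vanishing on
  the whole space, hence zero. Give the first \<open>d\<close> variables weight 1 and the others weight \<open>l\<close>,
  and let \<open>P\<^sub>0\<close> be the part of \<open>P\<close> of highest weight. The top form of the restriction is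
  \<open>P\<^sub>0 (t, \<rho>\<^sub>1 h\<^sub>1 (t), \<dots>)\<close>, which does not depend on the translation or on the lower terms of the
  graph polynomials. It is zero for every \<open>\<rho>\<close> and has degree below \<open>q\<close> in each \<open>\<rho>\<^sub>i\<close>, so each of
  its coefficients as a polynomial in \<open>\<rho>\<close> vanishes. Such a coefficient is a product of powers of
  the nonzero forms \<open>h\<^sub>i\<close> with a coefficient of \<open>P\<^sub>0\<close>; hence \<open>P\<^sub>0 = 0\<close>, a contradiction.
\<close>

section \<open>Coefficients of reduced polynomial functions over a finite field\<close>

text \<open>\<open>L x\<close> is the Lagrange basis polynomial at \<open>x\<close>. Both sides have
  degree below \<open>CARD('a)\<close> and agree at every point of the field, so their difference
  would have too many roots if it were nonzero.\<close>

lemma poly_eq_sum_lagrange: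
  fixes p :: "'a::{finite, field} poly"
  defines "L \<equiv> \<lambda>x. \<Prod>y\<in>UNIV - {x}. smult (inverse (x - y)) [:- y, 1:]"
  assumes "degree p < CARD('a)"
  shows "p = (\<Sum>x\<in>UNIV. smult (poly p x) (L x))"
proof -
  define r where "r = p - (\<Sum>x\<in>UNIV. smult (poly p x) (L x))"
  have pos: "0 < CARD('a)" by simp
  have deg_L: "degree (L x) \<le> CARD('a) - 1" for x
  proof -
    have "degree (L x) \<le> (\<Sum>y\<in>UNIV - {x}. degree (smult (inverse (x - y)) [:- y, 1:]))"
      unfolding L_def by (rule order_trans[OF degree_prod_sum_le]) (auto simp: o_def)
    also have "\<dots> \<le> (\<Sum>y\<in>UNIV - {x}. 1)"
      by (intro sum_mono) (simp add: degree_smult_le)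
    also have "\<dots> = CARD('a) - 1" by (simp add: card_Diff_singleton)
    finally show ?thesis .
  qed
  have L_eval: "poly (L x) y = (if x = y then 1 else 0)" for x y
  proof (cases "x = y")
    case True
    have "poly (smult (inverse (y - z)) [:- z, 1:]) y = inverse (y - z) * (y - z)" for z
      by (simp add: algebra_simps)
    moreover have "inverse (y - z) * (y - z) = 1" if "z \<noteq> y" for z
      using that by (intro left_inverse) simp
    ultimately have "poly (smult (inverse (y - z)) [:- z, 1:]) y = 1" if "z \<noteq> y" for z
      using that by (simp only:)
    with True show ?thesis by (auto simp: L_def poly_prod simp del: poly_smult intro!: prod.neutral)
  next
    case False
    then show ?thesis by (auto simp: L_def poly_prod intro!: prod_zero bexI[of _ y])
  qed
  have "degree (\<Sum>x\<in>UNIV. smult (poly p x) (L x)) \<le> CARD('a) - 1"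
    by (intro degree_sum_le) (auto intro!: order_trans[OF degree_smult_le deg_L] simp del: One_nat_def degree_smult_eq)
  then have deg_r: "degree r < CARD('a)"
    using assms pos unfolding r_def by (intro degree_diff_less) auto
  have "poly r y = 0" for y
    unfolding r_def by (simp add: poly_sum L_eval if_distrib sum.delta' cong: if_cong)
  then have "{x. poly r x = 0} = UNIV" by auto
  then have "r = 0"
    using card_poly_roots_bound[of r] deg_r by fastforce
  then show ?thesis unfolding r_def by simp
qed

text \<open>Take for \<open>\<phi> j x\<close> the coefficient of degree \<open>j\<close> of the
  Lagrange basis polynomial at \<open>x\<close>. Summing values against \<open>\<phi> j\<close> then
  extracts the \<open>j\<close>-th coefficient of any polynomial of degree below
  \<open>CARD('a)\<close>.\<close>

lemma exists_dual_powers: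
  "\<exists>\<phi> :: nat \<Rightarrow> 'a::{finite, field} \<Rightarrow> 'a.
     \<forall>i < CARD('a). \<forall>j. (\<Sum>x\<in>UNIV. \<phi> j x * x ^ i) = (if i = j then 1 else 0)"
proof -
  define L :: "'a \<Rightarrow> 'a poly" where
    "L = (\<lambda>x. \<Prod>y\<in>UNIV - {x}. smult (inverse (x - y)) [:- y, 1:])"
  have "(\<Sum>x\<in>UNIV. coeff (L x) j * x ^ i) = (if i = j then 1 else 0)"
    if "i < CARD('a)" for i j
  proof -
    have "monom 1 i = (\<Sum>x\<in>UNIV. smult (poly (monom 1 i) x) (L x))"
      unfolding L_def by (rule poly_eq_sum_lagrange) (simp add: that degree_monom_eq)
    then have "coeff (monom 1 i) j = coeff (\<Sum>x\<in>UNIV. smult (poly (monom 1 i) x) (L x)) j"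
      by simp
    then show ?thesis
      by (simp add: coeff_sum poly_monom mult.commute coeff_monom eq_commute split: if_splits)
  qed
  then show ?thesis by (intro exI[of _ "\<lambda>j x. coeff (L x) j"]) auto
qed

text \<open>The product over \<open>I\<close> of the functionals \<open>\<phi> (b i)\<close>
  isolates the exponent vector \<open>b\<close>. Several indices in \<open>E\<close> may share an
  exponent vector, so a sum over a fibre vanishes; this later permits grouping monomials by their
  exponents in some of the variables only.\<close>

lemma sum_coeffs_eq_0_if_vanishing:
  fixes c :: "'b \<Rightarrow> 'a::{finite, field}" and x :: "'b \<Rightarrow> nat \<Rightarrow> nat"
  assumes "finite I" and "finite E"
    and small: "\<And>e i. e \<in> E \<Longrightarrow> i \<in> I \<Longrightarrow> x e i < CARD('a)"
    and vanish: "\<And>t :: nat \<Rightarrow> 'a. (\<Sum>e\<in>E. c e * (\<Prod>i\<in>I. t i ^ x e i)) = 0"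
  shows "(\<Sum>e\<in>{e \<in> E. \<forall>i\<in>I. x e i = b i}. c e) = 0"
proof -
  obtain \<phi> :: "nat \<Rightarrow> 'a \<Rightarrow> 'a" where
    \<phi>: "\<And>i j. i < CARD('a) \<Longrightarrow> (\<Sum>x\<in>UNIV. \<phi> j x * x ^ i) = (if i = j then 1 else 0)"
    using exists_dual_powers by metis
  \<comment> \<open>The sum over the grid factors into one-variable sums, each of which is a
    Kronecker delta.\<close>
  have dual: "(\<Sum>t\<in>PiE I (\<lambda>_. UNIV). (\<Prod>i\<in>I. \<phi> (b i) (t i)) * (\<Prod>i\<in>I. t i ^ x e i)) =
      (if \<forall>i\<in>I. x e i = b i then 1 else 0)" if "e \<in> E" for e
  proof -
    have "(\<Sum>t\<in>PiE I (\<lambda>_. UNIV). (\<Prod>i\<in>I. \<phi> (b i) (t i)) * (\<Prod>i\<in>I. t i ^ x e i)) =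
        (\<Prod>i\<in>I. \<Sum>y\<in>UNIV. \<phi> (b i) y * y ^ x e i)"
      using \<open>finite I\<close> by (subst prod_sum_PiE) (simp_all add: prod.distrib)
    also have "\<dots> = (\<Prod>i\<in>I. if x e i = b i then 1 else 0)"
      using small[OF that] by (intro prod.cong) (simp_all add: \<phi>)
    also have "\<dots> = (if \<forall>i\<in>I. x e i = b i then 1 else 0)"
      using \<open>finite I\<close> by (auto intro!: prod_zero)
    finally show ?thesis .
  qed
  have "0 = (\<Sum>t\<in>PiE I (\<lambda>_. UNIV). (\<Prod>i\<in>I. \<phi> (b i) (t i)) *
      (\<Sum>e\<in>E. c e * (\<Prod>i\<in>I. t i ^ x e i)))"
    by (simp add: vanish)
  also have "\<dots> = (\<Sum>e\<in>E. c e *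
      (\<Sum>t\<in>PiE I (\<lambda>_. UNIV). (\<Prod>i\<in>I. \<phi> (b i) (t i)) * (\<Prod>i\<in>I. t i ^ x e i)))"
    unfolding sum_distrib_left by (subst sum.swap) (simp add: mult.left_commute)
  also have "\<dots> = (\<Sum>e\<in>E. if \<forall>i\<in>I. x e i = b i then c e else 0)"
    by (intro sum.cong) (simp_all add: dual)
  also have "\<dots> = (\<Sum>e\<in>{e \<in> E. \<forall>i\<in>I. x e i = b i}. c e)"
    using \<open>finite E\<close> by (simp add: sum.inter_filter)
  finally show ?thesis by simp
qed


section \<open>Evaluation and substitution\<close>

lemma poly_mapping_eq_sum_single:
  "p = (\<Sum>m\<in>Poly_Mapping.keys p. Poly_Mapping.single m (Poly_Mapping.lookup p m))"
  by (rule poly_mapping_eqI) (auto simp: lookup_sum lookup_single when_def in_keys_iff sum.delta)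

lemma lookup_single_0_mult:
  fixes p :: "'a::comm_semiring_1 mpoly"
  shows "Poly_Mapping.lookup (Poly_Mapping.single 0 c * p) m = c * Poly_Mapping.lookup p m"
  by (simp add: mult_map_scale_conv_mult[symmetric] map.rep_eq when_def)

lemma single_0_prod:
  "(\<Prod>i\<in>A. Poly_Mapping.single 0 (f i)) =
     (Poly_Mapping.single 0 (\<Prod>i\<in>A. f i) :: 'a::comm_semiring_1 mpoly)"
  by (induction A rule: infinite_finite_induct) (simp_all add: mult_single)

lemma single_0_power:
  "Poly_Mapping.single 0 c ^ k = (Poly_Mapping.single 0 (c ^ k) :: 'a::comm_semiring_1 mpoly)"
  by (induction k) (simp_all add: mult_single)

abbreviation var :: "nat \<Rightarrow> 'a::comm_semiring_1 mpoly" where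
  "var i \<equiv> Poly_Mapping.single (Poly_Mapping.single i 1) 1"

lemma var_power: "(var i :: 'a::comm_semiring_1 mpoly) ^ k = Poly_Mapping.single (Poly_Mapping.single i k) 1"
  by (induction k) (simp_all add: mult_single flip: single_add)

lemma prod_var_power:
  "(\<Prod>i\<in>A. (var i :: 'a::comm_semiring_1 mpoly) ^ e i) =
     Poly_Mapping.single (\<Sum>i\<in>A. Poly_Mapping.single i (e i)) 1"
proof (induction A rule: infinite_finite_induct)
  case (insert x A)
  then show ?case by (simp add: var_power mult_single del: One_nat_def)
qed simp_all

section \<open>Evaluation at a vector\<close>

definition eval_monom :: "(nat \<Rightarrow>\<^sub>0 nat) \<Rightarrow> 'a::comm_semiring_1 vec \<Rightarrow> 'a" where
  "eval_monom m t = (\<Prod>i\<in>Poly_Mapping.keys m. (t $ i) ^ Poly_Mapping.lookup m i)"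

text \<open>Indices outside the support contribute a zeroth power. Enlarging the index set lets
  monomials with different supports be compared over one common set.\<close>

lemma eval_monom_superset:
  assumes "finite A" and "Poly_Mapping.keys m \<subseteq> A"
  shows "eval_monom m t = (\<Prod>i\<in>A. (t $ i) ^ Poly_Mapping.lookup m i)"
  unfolding eval_monom_def using assms
  by (intro prod.mono_neutral_left) (auto simp: in_keys_iff)

lemma eval_monom_add: "eval_monom (m + m') t = eval_monom m t * eval_monom m' t"
proof -
  let ?A = "Poly_Mapping.keys m \<union> Poly_Mapping.keys m'"
  have "Poly_Mapping.keys (m + m') \<subseteq> ?A" by (rule keys_add)
  then show ?thesis
    by (simp add: eval_monom_superset[of ?A] lookup_add power_add prod.distrib)
qed

lemma eval_mpoly_superset:
  assumes "finite M" and "Poly_Mapping.keys p \<subseteq> M"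
  shows "eval_mpoly p t = (\<Sum>m\<in>M. Poly_Mapping.lookup p m * eval_monom m t)"
  unfolding eval_mpoly_def eval_monom_def[symmetric] using assms
  by (intro sum.mono_neutral_left) (auto simp: in_keys_iff)

lemma eval_mpoly_zero [simp]: "eval_mpoly 0 t = 0"
  by (simp add: eval_mpoly_def)

lemma eval_mpoly_single [simp]: "eval_mpoly (Poly_Mapping.single m c) t = c * eval_monom m t"
  by (subst eval_mpoly_superset[of "{m}"]) auto

lemma eval_monom_zero [simp]: "eval_monom 0 t = 1"
  by (simp add: eval_monom_def)

lemma eval_monom_single [simp]: "eval_monom (Poly_Mapping.single i k) t = (t $ i) ^ k"
  by (subst eval_monom_superset[of "{i}"]) auto

lemma eval_mpoly_add: "eval_mpoly (p + p') t = eval_mpoly p t + eval_mpoly p' t"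
proof -
  let ?M = "Poly_Mapping.keys p \<union> Poly_Mapping.keys p'"
  have "Poly_Mapping.keys (p + p') \<subseteq> ?M" by (rule keys_add)
  then show ?thesis
    by (simp add: eval_mpoly_superset[of ?M] lookup_add distrib_right sum.distrib)
qed

lemma eval_mpoly_sum: "eval_mpoly (\<Sum>x\<in>A. p x) t = (\<Sum>x\<in>A. eval_mpoly (p x) t)"
  by (induction A rule: infinite_finite_induct) (simp_all add: eval_mpoly_add)

lemma eval_mpoly_mult: "eval_mpoly (p * p') t = eval_mpoly p t * eval_mpoly p' t"
proof -
  have "p * p' = (\<Sum>m\<in>Poly_Mapping.keys p. \<Sum>m'\<in>Poly_Mapping.keys p'.
      Poly_Mapping.single (m + m') (Poly_Mapping.lookup p m * Poly_Mapping.lookup p' m'))"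
    by (subst poly_mapping_eq_sum_single[of p], subst poly_mapping_eq_sum_single[of p'])
      (simp add: sum_product mult_single)
  then have "eval_mpoly (p * p') t = (\<Sum>m\<in>Poly_Mapping.keys p. \<Sum>m'\<in>Poly_Mapping.keys p'.
      Poly_Mapping.lookup p m * Poly_Mapping.lookup p' m' * (eval_monom m t * eval_monom m' t))"
    by (simp add: eval_mpoly_sum eval_monom_add)
  also have "\<dots> = eval_mpoly p t * eval_mpoly p' t"
    by (simp add: eval_mpoly_def flip: eval_monom_def) (simp add: sum_product mult_ac)
  finally show ?thesis .
qed

lemma eval_mpoly_one [simp]: "eval_mpoly 1 t = 1"
  by (simp flip: single_one)

lemma eval_mpoly_power: "eval_mpoly (p ^ k) t = eval_mpoly p t ^ k"
  by (induction k) (simp_all add: eval_mpoly_mult)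

lemma eval_mpoly_prod: "eval_mpoly (\<Prod>x\<in>A. p x) t = (\<Prod>x\<in>A. eval_mpoly (p x) t)"
  by (induction A rule: infinite_finite_induct) (simp_all add: eval_mpoly_mult)

section \<open>Substitution of polynomials for the variables\<close>

definition subst_mpoly :: "(nat \<Rightarrow> 'a mpoly) \<Rightarrow> 'a::comm_semiring_1 mpoly \<Rightarrow> 'a mpoly" where
  "subst_mpoly f p = (\<Sum>m\<in>Poly_Mapping.keys p. Poly_Mapping.single 0 (Poly_Mapping.lookup p m) *
     (\<Prod>i\<in>Poly_Mapping.keys m. f i ^ Poly_Mapping.lookup m i))"

text \<open>Turns the restriction of \<open>p\<close> to a parametrised set into a polynomial in the
  parameters: \<open>f i\<close> describes coordinate \<open>i\<close> of the point.\<close>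

lemma eval_subst_mpoly:
  assumes "p \<in> polys_in n" and "\<And>i. i < n \<Longrightarrow> v $ i = eval_mpoly (f i) t"
  shows "eval_mpoly (subst_mpoly f p) t = eval_mpoly p v"
  unfolding subst_mpoly_def eval_mpoly_sum eval_mpoly_mult eval_mpoly_prod eval_mpoly_power
    eval_mpoly_def[of p]
  using assms
  by (intro sum.cong arg_cong2[of _ _ _ _ "(*)"] prod.cong arg_cong2[of _ _ _ _ "(^)"])
    (auto simp: polys_in_def intro!: assms(2)[symmetric])

section \<open>Polynomials in the first \<open>d\<close> variables\<close>

lemma polys_in_single_0: "Poly_Mapping.single 0 c \<in> polys_in d"
  by (auto simp: polys_in_def split: if_splits)

lemma polys_in_var: "i < d \<Longrightarrow> var i \<in> polys_in d"
  by (auto simp: polys_in_def)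

lemma polys_in_add:
  fixes p p' :: "'a::comm_monoid_add mpoly"
  shows "p \<in> polys_in d \<Longrightarrow> p' \<in> polys_in d \<Longrightarrow> p + p' \<in> polys_in d"
  using keys_add[of p p'] by (fastforce simp: polys_in_def)

lemma polys_in_sum:
  fixes p :: "'b \<Rightarrow> 'a::comm_monoid_add mpoly"
  shows "(\<And>x. x \<in> A \<Longrightarrow> p x \<in> polys_in d) \<Longrightarrow> (\<Sum>x\<in>A. p x) \<in> polys_in d"
proof (induction A rule: infinite_finite_induct)
  case (insert x A)
  then show ?case by (simp add: polys_in_add)
qed (simp_all add: polys_in_def)

lemma polys_in_mult:
  fixes p p' :: "'a::comm_semiring_1 mpoly"
  assumes "p \<in> polys_in d" and "p' \<in> polys_in d"
  shows "p * p' \<in> polys_in d"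
  unfolding polys_in_def
proof (intro CollectI ballI)
  fix m assume "m \<in> Poly_Mapping.keys (p * p')"
  then obtain a b where "m = a + b" "a \<in> Poly_Mapping.keys p" "b \<in> Poly_Mapping.keys p'"
    using keys_mult[of p p'] by blast
  then show "Poly_Mapping.keys m \<subseteq> {..<d}"
    using assms keys_add[of a b] by (fastforce simp: polys_in_def)
qed

lemma polys_in_one: "(1 :: 'a::comm_semiring_1 mpoly) \<in> polys_in d"
  using polys_in_single_0[of "1 :: 'a" d] by simp

lemma polys_in_power:
  fixes p :: "'a::comm_semiring_1 mpoly"
  shows "p \<in> polys_in d \<Longrightarrow> p ^ k \<in> polys_in d"
  by (induction k) (simp_all add: polys_in_one polys_in_mult)

lemma polys_in_prod:
  fixes p :: "'b \<Rightarrow> 'a::comm_semiring_1 mpoly"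
  shows "(\<And>x. x \<in> A \<Longrightarrow> p x \<in> polys_in d) \<Longrightarrow> (\<Prod>x\<in>A. p x) \<in> polys_in d"
  by (induction A rule: infinite_finite_induct) (simp_all add: polys_in_one polys_in_mult)

lemma polys_in_subst:
  assumes "p \<in> polys_in n" and "\<And>i. i < n \<Longrightarrow> f i \<in> polys_in d"
  shows "subst_mpoly f p \<in> polys_in d"
  unfolding subst_mpoly_def using assms(1)
  by (intro polys_in_sum polys_in_mult polys_in_single_0 polys_in_prod polys_in_power assms(2))
    (auto simp: polys_in_def)

section \<open>Vanishing polynomials of low degree\<close>

lemma lookup_le_monom_degree: "Poly_Mapping.lookup m i \<le> monom_degree m"
proof (cases "i \<in> Poly_Mapping.keys m")
  case True
  then show ?thesis unfolding monom_degree_def by (intro member_le_sum) auto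
next
  case False
  then show ?thesis by (simp add: in_keys_iff)
qed

text \<open>The degree bound keeps every single exponent below \<open>CARD('a)\<close>, so each
  coefficient can be read off from the values.\<close>

lemma eq_0_if_vanishing:
  fixes p :: "'a::{finite, field} mpoly"
  assumes p: "p \<in> polys_in d"
    and deg: "\<And>m. m \<in> Poly_Mapping.keys p \<Longrightarrow> monom_degree m < CARD('a)"
    and vanish: "\<And>t. t \<in> carrier_vec d \<Longrightarrow> eval_mpoly p t = 0"
  shows "p = 0"
proof (rule ccontr)
  assume "p \<noteq> 0"
  then obtain m0 where m0: "m0 \<in> Poly_Mapping.keys p"
    by (metis all_not_in_conv keys_eq_empty)
  have sub: "Poly_Mapping.keys m \<subseteq> {..<d}" if "m \<in> Poly_Mapping.keys p" for m
    using p that by (auto simp: polys_in_def)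
  have "(\<Sum>m\<in>{m \<in> Poly_Mapping.keys p. \<forall>i\<in>{..<d}. Poly_Mapping.lookup m i = Poly_Mapping.lookup m0 i}.
      Poly_Mapping.lookup p m) = 0"
  proof (rule sum_coeffs_eq_0_if_vanishing)
    fix m i assume "m \<in> Poly_Mapping.keys p"
    then show "Poly_Mapping.lookup m i < CARD('a)"
      using deg[of m] lookup_le_monom_degree[of m i] by linarith
  next
    fix t :: "nat \<Rightarrow> 'a"
    have "(\<Sum>m\<in>Poly_Mapping.keys p. Poly_Mapping.lookup p m * (\<Prod>i<d. t i ^ Poly_Mapping.lookup m i)) =
        eval_mpoly p (vec d t)"
      unfolding eval_mpoly_superset[OF finite_keys subset_refl]
      by (intro sum.cong refl) (simp add: sub eval_monom_superset[of "{..<d}"])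
    then show "(\<Sum>m\<in>Poly_Mapping.keys p. Poly_Mapping.lookup p m * (\<Prod>i<d. t i ^ Poly_Mapping.lookup m i)) = 0"
      by (simp add: vanish)
  qed auto
  \<comment> \<open>The fibre of \<open>m0\<close> is a singleton: variables of index at least
    \<open>d\<close> occur in neither monomial.\<close>
  moreover have "m = m0" if "m \<in> Poly_Mapping.keys p"
    "\<forall>i\<in>{..<d}. Poly_Mapping.lookup m i = Poly_Mapping.lookup m0 i" for m
  proof (rule poly_mapping_eqI)
    fix i
    show "Poly_Mapping.lookup m i = Poly_Mapping.lookup m0 i"
      using that(2) sub[OF that(1)] sub[OF m0]
      by (cases "i < d") (simp, metis in_keys_iff lessThan_iff subsetD)
  qed
  then have "{m \<in> Poly_Mapping.keys p. \<forall>i\<in>{..<d}. Poly_Mapping.lookup m i = Poly_Mapping.lookup m0 i} = {m0}"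
    using m0 by auto
  ultimately show False using m0 by (simp add: in_keys_iff)
qed


section \<open>Leading forms\<close>

text \<open>The zero form is allowed here, so that summands of lower degree also have a top form.\<close>

definition top_form :: "nat \<Rightarrow> 'a::comm_ring_1 mpoly \<Rightarrow> 'a mpoly \<Rightarrow> bool" where
  "top_form s h p \<longleftrightarrow> (\<forall>m\<in>Poly_Mapping.keys h. monom_degree m = s) \<and>
     (\<forall>m\<in>Poly_Mapping.keys (p - h). monom_degree m < s)"

lemma monom_degree_superset:
  assumes "finite A" and "Poly_Mapping.keys m \<subseteq> A"
  shows "monom_degree m = (\<Sum>i\<in>A. Poly_Mapping.lookup m i)"
  unfolding monom_degree_def using assms
  by (intro sum.mono_neutral_left) (auto simp: in_keys_iff)

lemma monom_degree_add: "monom_degree (m + m') = monom_degree m + monom_degree m'"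
proof -
  let ?A = "Poly_Mapping.keys m \<union> Poly_Mapping.keys m'"
  have "Poly_Mapping.keys (m + m') \<subseteq> ?A" by (rule keys_add)
  then show ?thesis
    by (simp add: monom_degree_superset[of ?A] lookup_add sum.distrib)
qed

lemma monom_degree_zero [simp]: "monom_degree 0 = 0"
  by (simp add: monom_degree_def)

lemma monom_degree_single [simp]: "monom_degree (Poly_Mapping.single i k) = k"
  by (subst monom_degree_superset[of "{i}"]) auto

lemma keys_add_cases:
  "m \<in> Poly_Mapping.keys (p + p') \<Longrightarrow> m \<in> Poly_Mapping.keys p \<or> m \<in> Poly_Mapping.keys p'"
  using keys_add[of p p'] by auto

lemma keys_mult_cases:
  assumes "m \<in> Poly_Mapping.keys (p * p')"
  obtains a b where "m = a + b" "a \<in> Poly_Mapping.keys p" "b \<in> Poly_Mapping.keys p'"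
  using assms keys_mult[of p p'] by blast

lemma top_form_mult:
  assumes "top_form s h p" and "top_form s' h' p'"
  shows "top_form (s + s') (h * h') (p * p')"
proof -
  \<comment> \<open>Each of the three summands contains a factor \<open>p - h\<close> or
    \<open>p' - h'\<close>, which lowers the degree strictly.\<close>
  have "p * p' - h * h' = (p - h) * (p' - h') + ((p - h) * h' + h * (p' - h'))"
    by (simp add: algebra_simps)
  moreover have "monom_degree m < s + s'"
    if "m \<in> Poly_Mapping.keys ((p - h) * (p' - h') + ((p - h) * h' + h * (p' - h')))" for m
    using that assms unfolding top_form_def
    by (elim keys_add_cases[elim_format] disjE keys_mult_cases)
      (simp_all add: monom_degree_add add_strict_mono)
  moreover have "monom_degree m = s + s'" if "m \<in> Poly_Mapping.keys (h * h')" for m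
    using that assms unfolding top_form_def
    by (elim keys_mult_cases) (simp add: monom_degree_add)
  ultimately show ?thesis by (simp add: top_form_def)
qed

lemma top_form_one: "top_form 0 1 1"
  by (simp add: top_form_def)

lemma top_form_single_0: "top_form 0 (Poly_Mapping.single 0 c) (Poly_Mapping.single 0 c)"
  by (simp add: top_form_def)

lemma top_form_power: "top_form s h p \<Longrightarrow> top_form (s * k) (h ^ k) (p ^ k)"
  by (induction k) (simp_all add: top_form_one top_form_mult)

lemma top_form_prod:
  "(\<And>x. x \<in> A \<Longrightarrow> top_form (s x) (h x) (p x)) \<Longrightarrow> top_form (\<Sum>x\<in>A. s x) (\<Prod>x\<in>A. h x) (\<Prod>x\<in>A. p x)"
  by (induction A rule: infinite_finite_induct) (simp_all add: top_form_one top_form_mult)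

lemma top_form_add:
  assumes "top_form s h p" and "top_form s h' p'"
  shows "top_form s (h + h') (p + p')"
proof -
  have eq: "p + p' - (h + h') = (p - h) + (p' - h')" by simp
  show ?thesis
    using assms unfolding top_form_def eq by (blast dest: keys_add_cases)
qed

lemma top_form_sum:
  "(\<And>x. x \<in> A \<Longrightarrow> top_form s (h x) (p x)) \<Longrightarrow> top_form s (\<Sum>x\<in>A. h x) (\<Sum>x\<in>A. p x)"
  by (induction A rule: infinite_finite_induct) (auto simp: top_form_add, simp_all add: top_form_def)

lemma top_form_degree_le:
  assumes "top_form s h p" and "m \<in> Poly_Mapping.keys p"
  shows "monom_degree m \<le> s"
proof -
  have "m \<in> Poly_Mapping.keys (h + (p - h))" using assms(2) by simp
  from keys_add_cases[OF this] show ?thesis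
    using assms(1) unfolding top_form_def by (auto intro: less_imp_le)
qed

text \<open>This is how translations and monomials of smaller weight drop out of a top form.\<close>

lemma top_form_zero_if_less: "top_form s h p \<Longrightarrow> s < s' \<Longrightarrow> top_form s' 0 p"
  using top_form_degree_le[of s h p] by (fastforce simp: top_form_def)

lemma top_form_of_zero: "top_form s h 0 \<Longrightarrow> h = 0"
  unfolding top_form_def by (metis all_not_in_conv diff_0 keys_eq_empty keys_minus less_irrefl)

text \<open>Since \<open>h\<close> is nonzero, one of its monomials identifies the total degree of
  \<open>g\<close> with \<open>l\<close>.\<close>

lemma top_form_if_leading_form:
  assumes "leading_form g = h" and "homogeneous_of_degree l h"
  shows "top_form l h g"
proof -
  have look: "Poly_Mapping.lookup h m = (if monom_degree m = total_degree g then Poly_Mapping.lookup g m else 0)" for m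
    using assms(1) lookup_homogeneous_part[of "total_degree g" g m] by (simp add: leading_form_def)
  obtain m where "m \<in> Poly_Mapping.keys h"
    using assms(2) unfolding homogeneous_of_degree_def by (metis all_not_in_conv keys_eq_empty)
  then have l: "total_degree g = l"
    using assms(2) look[of m] unfolding homogeneous_of_degree_def by (metis in_keys_iff)
  have "monom_degree m < l" if "m \<in> Poly_Mapping.keys (g - h)" for m
  proof -
    have "m \<in> Poly_Mapping.keys g" "monom_degree m \<noteq> l"
      using that look[of m] l by (auto simp: in_keys_iff lookup_minus split: if_splits)
    moreover from this have "monom_degree m \<le> total_degree g"
      unfolding total_degree_def by (intro Max_ge) auto
    ultimately show ?thesis using l by simp
  qed
  then show ?thesis using assms(2) by (simp add: top_form_def homogeneous_of_degree_def)
qed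

definition weight :: "(nat \<Rightarrow> nat) \<Rightarrow> (nat \<Rightarrow>\<^sub>0 nat) \<Rightarrow> nat" where
  "weight w m = (\<Sum>i\<in>Poly_Mapping.keys m. w i * Poly_Mapping.lookup m i)"

text \<open>A monomial \<open>m\<close> of \<open>p\<close> turns into a product with top form in
  degree \<open>weight w m\<close>, so only monomials of weight exactly \<open>D\<close> reach
  degree \<open>D\<close>. Their forms may cancel, which \<open>top_form\<close> allows.\<close>

lemma top_form_subst:
  assumes p: "p \<in> polys_in n"
    and f: "\<And>i. i < n \<Longrightarrow> top_form (w i) (h i) (f i)"
    and D: "\<And>m. m \<in> Poly_Mapping.keys p \<Longrightarrow> weight w m \<le> D"
  shows "top_form D
    (\<Sum>m\<in>{m \<in> Poly_Mapping.keys p. weight w m = D}. Poly_Mapping.single 0 (Poly_Mapping.lookup p m) *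
       (\<Prod>i\<in>Poly_Mapping.keys m. h i ^ Poly_Mapping.lookup m i))
    (subst_mpoly f p)"
  unfolding subst_mpoly_def sum.inter_filter[OF finite_keys]
proof (rule top_form_sum)
  fix m assume m: "m \<in> Poly_Mapping.keys p"
  let ?c = "Poly_Mapping.single 0 (Poly_Mapping.lookup p m) :: 'a mpoly"
  have "top_form (0 + weight w m) (?c * (\<Prod>i\<in>Poly_Mapping.keys m. h i ^ Poly_Mapping.lookup m i))
      (?c * (\<Prod>i\<in>Poly_Mapping.keys m. f i ^ Poly_Mapping.lookup m i))"
    unfolding weight_def using p m
    by (intro top_form_mult top_form_single_0 top_form_prod top_form_power f) (auto simp: polys_in_def)
  then show "top_form D (if weight w m = D then ?c * (\<Prod>i\<in>Poly_Mapping.keys m. h i ^ Poly_Mapping.lookup m i) else 0)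
      (?c * (\<Prod>i\<in>Poly_Mapping.keys m. f i ^ Poly_Mapping.lookup m i))"
    using D[OF m] by (auto intro: top_form_zero_if_less)
qed


section \<open>Interpolating polynomials of low degree\<close>

text \<open>Stars and bars: a list of \<open>n + 1\<close> naturals with sum \<open>k\<close> gives
  a monomial in \<open>n\<close> variables, its last entry being the slack between the degree and
  \<open>k\<close>.\<close>

lemma card_monoms_degree_le:
  obtains M :: "(nat \<Rightarrow>\<^sub>0 nat) set" where "finite M" and "card M = (k + n) choose n"
    and "\<And>m. m \<in> M \<Longrightarrow> Poly_Mapping.keys m \<subseteq> {..<n} \<and> monom_degree m \<le> k"
proof -
  define Ls where "Ls = {xs :: nat list. length xs = n + 1 \<and> sum_list xs = k}"
  define f where "f = (\<lambda>xs :: nat list. \<Sum>i<n. Poly_Mapping.single i (xs ! i))"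
  have card_Ls: "card Ls = (k + n) choose n"
    using card_length_sum_list[of "n + 1" k] binomial_symmetric[of k "k + n"] by (simp add: Ls_def)
  \<comment> \<open>An infinite set has cardinality 0, whereas this binomial coefficient is
    positive.\<close>
  then have fin: "finite Ls" by (metis card.infinite le_add2 zero_less_binomial less_irrefl)
  have look: "Poly_Mapping.lookup (f xs) i = (if i < n then xs ! i else 0)" for xs i
    by (simp add: f_def lookup_sum lookup_single when_def sum.delta')
  have total: "(\<Sum>i<n. xs ! i) + xs ! n = k" if "xs \<in> Ls" for xs
    using that by (auto simp: Ls_def sum_list_sum_nth atLeast0LessThan)
  have inj: "inj_on f Ls"
  proof (rule inj_onI)
    fix xs ys assume xs: "xs \<in> Ls" and ys: "ys \<in> Ls" and eq: "f xs = f ys"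
    have init: "xs ! i = ys ! i" if "i < n" for i
      using look[of xs i] look[of ys i] eq that by simp
    moreover have "xs ! n = ys ! n"
      using total[OF xs] total[OF ys] init by simp
    ultimately show "xs = ys"
      using xs ys by (intro nth_equalityI) (auto simp: Ls_def less_Suc_eq)
  qed
  have keys: "Poly_Mapping.keys (f xs) \<subseteq> {..<n}" for xs
    by (auto simp: in_keys_iff look split: if_splits)
  have "monom_degree (f xs) \<le> k" if "xs \<in> Ls" for xs
    using total[OF that] keys by (simp add: monom_degree_superset[of "{..<n}"] look)
  with keys show ?thesis
    by (intro that[of "f ` Ls"]) (auto simp: fin card_image[OF inj] card_Ls)
qed

text \<open>Pigeonhole in place of a rank argument: there are more coefficient functions on
  \<open>M\<close> than value functions on \<open>S\<close>, so two of them have equal values on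
  \<open>S\<close>, and their difference supplies the coefficients of \<open>p\<close>.\<close>

lemma exists_vanishing_mpoly:
  fixes S :: "'a::{finite, field} vec set"
  assumes "finite S" and "finite M" and "card S < card M"
  obtains p :: "'a mpoly" where "p \<noteq> 0" and "Poly_Mapping.keys p \<subseteq> M"
    and "\<And>s. s \<in> S \<Longrightarrow> eval_mpoly p s = 0"
proof -
  define ev where "ev = (\<lambda>c. restrict (\<lambda>s. \<Sum>m\<in>M. c m * eval_monom m s) S)"
  let ?A = "PiE M (\<lambda>_. UNIV :: 'a set)" and ?B = "PiE S (\<lambda>_. UNIV :: 'a set)"
  have "CARD('a) ^ card S < CARD('a) ^ card M"
    using assms(3) card_mono[of UNIV "{0, 1 :: 'a}"] by (intro power_strict_increasing) auto
  then have "card ?B < card ?A"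
    using assms(1,2) by (simp add: card_PiE)
  moreover have "ev ` ?A \<subseteq> ?B" by (auto simp: ev_def)
  moreover have "finite ?B" using assms(1) by (simp add: finite_PiE)
  ultimately have "\<not> inj_on ev ?A"
    using card_inj_on_le[of ev ?A ?B] by linarith
  then obtain c c' where c: "c \<in> ?A" "c' \<in> ?A" "ev c = ev c'" "c \<noteq> c'"
    by (auto simp: inj_on_def)
  define p where "p = (\<Sum>m\<in>M. Poly_Mapping.single m (c m - c' m))"
  have look: "Poly_Mapping.lookup p m = (if m \<in> M then c m - c' m else 0)" for m
    using assms(2) by (simp add: p_def lookup_sum lookup_single when_def sum.delta')
  \<comment> \<open>Both functions are extensional on \<open>M\<close>, so they must differ at a
    point of \<open>M\<close>.\<close>
  obtain m where "m \<in> M" "c m \<noteq> c' m" using c PiE_ext by metis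
  then have "Poly_Mapping.lookup p m \<noteq> 0" by (simp add: look)
  then have "p \<noteq> 0" by auto
  moreover have "Poly_Mapping.keys p \<subseteq> M" by (auto simp: in_keys_iff look split: if_splits)
  moreover have "eval_mpoly p s = 0" if "s \<in> S" for s
  proof -
    have "(\<Sum>m\<in>M. c m * eval_monom m s) = (\<Sum>m\<in>M. c' m * eval_monom m s)"
      using fun_cong[OF c(3), of s] that by (simp add: ev_def)
    then show ?thesis by (simp add: p_def eval_mpoly_sum left_diff_distrib sum_subtractf)
  qed
  ultimately show ?thesis using that by blast
qed

section \<open>The lower bound for BRK-type sets\<close>

theorem theorem1p2:
  fixes S :: "'a::{finite, field} vec set"
    and q n d l :: nat
  assumes "CARD('a) = q"
    and "n \<ge> 2"
    and "1 \<le> d" and "d \<le> n - 1"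
    and "l \<ge> 2"
    and "BRK_type_set n d l S"
  shows "card S \<ge> ((q - 1) div l + n) choose n"
proof (rule ccontr)
  define k where "k = (q - 1) div l"
  assume "\<not> ?thesis"
  then have small: "card S < (k + n) choose n" by (simp add: k_def)
  have q_pos: "0 < q" using assms(1) by auto
  have kl: "l * k \<le> q - 1" unfolding k_def by simp
  from assms(6) obtain h :: "nat \<Rightarrow> 'a mpoly" where S: "S \<subseteq> carrier_vec n"
    and h: "\<And>i. i < n - d \<Longrightarrow> homogeneous_of_degree l (h i)"
    and brk: "\<And>\<rho>. \<rho> \<in> carrier_vec (n - d) \<Longrightarrow> \<exists>a \<in> carrier_vec n. \<exists>g :: nat \<Rightarrow> 'a mpoly.
             (\<forall>i<n - d. g i \<in> polys_with_leading_form d (h i)) \<and>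
             {a + (t @\<^sub>v vec (n - d) (\<lambda>i. \<rho> $ i * eval_mpoly (g i) t)) | t. t \<in> carrier_vec d} \<subseteq> S"
    unfolding BRK_type_set_def by blast
  have "finite (carrier_vec n :: 'a vec set)"
  proof (rule finite_subset)
    show "carrier_vec n \<subseteq> vec_of_list ` {xs :: 'a list. set xs \<subseteq> UNIV \<and> length xs = n}"
    proof
      fix v :: "'a vec" assume "v \<in> carrier_vec n"
      then show "v \<in> vec_of_list ` {xs :: 'a list. set xs \<subseteq> UNIV \<and> length xs = n}"
        by (intro image_eqI[of _ _ "list_of_vec v"]) (auto simp: vec_list)
    qed
  qed (intro finite_imageI finite_lists_length_eq finite)
  with S have "finite S" by (rule finite_subset)
  obtain M where M: "finite M" "card M = (k + n) choose n"
      "\<And>m. m \<in> M \<Longrightarrow> Poly_Mapping.keys m \<subseteq> {..<n} \<and> monom_degree m \<le> k"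
    using card_monoms_degree_le[of k n] by blast
  obtain p :: "'a mpoly" where "p \<noteq> 0" and keys_p: "Poly_Mapping.keys p \<subseteq> M"
    and p_S: "\<And>s. s \<in> S \<Longrightarrow> eval_mpoly p s = 0"
    using exists_vanishing_mpoly[OF \<open>finite S\<close> M(1)] small M(2) by auto
  have p_in: "p \<in> polys_in n" using keys_p M(3) by (fastforce simp: polys_in_def)

  \<comment> \<open>The weight of a variable is the degree of the form that will replace it: 1 for a
    parameter of the graph, \<open>l\<close> for a graph polynomial.\<close>
  define w where "w = (\<lambda>i. if i < d then 1 else l)"
  have weight_le: "weight w m \<le> q - 1" if "m \<in> Poly_Mapping.keys p" for m
  proof -
    have "weight w m \<le> (\<Sum>i\<in>Poly_Mapping.keys m. l * Poly_Mapping.lookup m i)"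
      unfolding weight_def w_def using \<open>l \<ge> 2\<close> by (intro sum_mono) auto
    also have "\<dots> = l * monom_degree m" by (simp add: monom_degree_def sum_distrib_left)
    also have "\<dots> \<le> l * k" using that keys_p M(3)[of m] by auto
    finally show ?thesis using kl by simp
  qed
  define D where "D = Max (weight w ` Poly_Mapping.keys p)"
  have "Poly_Mapping.keys p \<noteq> {}" using \<open>p \<noteq> 0\<close> by (metis keys_eq_empty)
  then have "D \<in> weight w ` Poly_Mapping.keys p"
    unfolding D_def by (intro Max_in) auto
  \<comment> \<open>The contradiction will be that the coefficient of \<open>p\<close> at this
    monomial of highest weight is zero.\<close>
  then obtain m0 where m0: "m0 \<in> Poly_Mapping.keys p" "weight w m0 = D" by blast
  have D_ge: "weight w m \<le> D" if "m \<in> Poly_Mapping.keys p" for m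
    unfolding D_def using that by simp
  define K where "K = {m \<in> Poly_Mapping.keys p. weight w m = D}"
  have "finite K" by (simp add: K_def)
  have keys_K: "Poly_Mapping.keys m \<subseteq> {..<n}" if "m \<in> K" for m
    using that keys_p M(3) by (auto simp: K_def)

  \<comment> \<open>The form replacing variable \<open>i\<close>, without the factor from
    \<open>\<rho>\<close>. Coordinate \<open>i \<ge> d\<close> belongs to graph polynomial
    \<open>i - d\<close>.\<close>
  define b where "b = (\<lambda>i. if i < d then var i else h (i - d))"
  define B where "B = (\<lambda>m. \<Prod>i<n. b i ^ Poly_Mapping.lookup m i)"
  have top_zero: "(\<Sum>m\<in>K. Poly_Mapping.single 0
      (Poly_Mapping.lookup p m * (\<Prod>i\<in>{d..<n}. t i ^ Poly_Mapping.lookup m i)) * B m) = 0"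
    for t :: "nat \<Rightarrow> 'a"
  proof -
    define \<rho> where "\<rho> = vec (n - d) (\<lambda>i. t (i + d))"
    have "\<rho> \<in> carrier_vec (n - d)" by (simp add: \<rho>_def)
    from brk[OF this] obtain a g where a: "a \<in> carrier_vec n"
      and g: "\<And>i. i < n - d \<Longrightarrow> g i \<in> polys_with_leading_form d (h i)"
      and sub: "{a + (t @\<^sub>v vec (n - d) (\<lambda>i. \<rho> $ i * eval_mpoly (g i) t)) | t. t \<in> carrier_vec d} \<subseteq> S"
      by blast
    \<comment> \<open>The scalar attached to \<open>b i\<close>: for \<open>i \<ge> d\<close> it is
      the entry of \<open>\<rho>\<close> at \<open>i - d\<close>, and the value 1 below
      \<open>d\<close> makes all coordinates uniform.\<close>
    define r where "r = (\<lambda>i. if i < d then 1 else t i)"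
    define f where "f = (\<lambda>i. Poly_Mapping.single 0 (a $ i) +
      (if i < d then var i else Poly_Mapping.single 0 (t i) * g (i - d)))"
    have top_f: "top_form (w i) (Poly_Mapping.single 0 (r i) * b i) (f i)" if "i < n" for i
    proof (cases "i < d")
      case True
      have "top_form 1 (var i) (var i :: 'a mpoly)" by (simp add: top_form_def)
      with top_form_zero_if_less[OF top_form_single_0]
      have "top_form 1 (0 + var i) (Poly_Mapping.single 0 (a $ i) + var i)"
        by (intro top_form_add) auto
      with True show ?thesis by (simp add: w_def r_def b_def f_def)
    next
      case False
      with that have "i - d < n - d" by auto
      then have "top_form l (h (i - d)) (g (i - d))"
        using g h by (intro top_form_if_leading_form) (auto simp: polys_with_leading_form_def)
      \<comment> \<open>For \<open>t i = 0\<close> both products are zero; \<open>top_form\<close>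
        covers this case as well.\<close>
      with top_form_mult[OF top_form_single_0]
      have "top_form l (Poly_Mapping.single 0 (t i) * h (i - d)) (Poly_Mapping.single 0 (t i) * g (i - d))"
        by fastforce
      moreover have "top_form l 0 (Poly_Mapping.single 0 (a $ i))"
        using \<open>l \<ge> 2\<close> by (intro top_form_zero_if_less[OF top_form_single_0]) simp
      ultimately have "top_form l (0 + Poly_Mapping.single 0 (t i) * h (i - d))
          (Poly_Mapping.single 0 (a $ i) + Poly_Mapping.single 0 (t i) * g (i - d))"
        by (intro top_form_add) auto
      with False show ?thesis by (simp add: w_def r_def b_def f_def)
    qed
    note top = top_form_subst[OF p_in top_f D_ge, folded K_def]
    \<comment> \<open>The restriction to the graph has degree at most \<open>D \<le> q - 1\<close>
      and vanishes at every parameter, because the graph lies in \<open>S\<close>.\<close>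
    have subst_zero: "subst_mpoly f p = 0"
    proof (rule eq_0_if_vanishing)
      show "subst_mpoly f p \<in> polys_in d"
      proof (rule polys_in_subst[OF p_in])
        fix i assume "i < n"
        then show "f i \<in> polys_in d"
          using g[of "i - d"] unfolding f_def polys_with_leading_form_def
          by (auto intro!: polys_in_add polys_in_mult polys_in_single_0 polys_in_var simp del: One_nat_def)
      qed
      show "monom_degree m < CARD('a)" if "m \<in> Poly_Mapping.keys (subst_mpoly f p)" for m
        using top_form_degree_le[OF top that] weight_le[OF m0(1)] m0(2) q_pos assms(1) by auto
    next
      fix u :: "'a vec" assume u: "u \<in> carrier_vec d"
      let ?v = "a + (u @\<^sub>v vec (n - d) (\<lambda>i. \<rho> $ i * eval_mpoly (g i) u))"
      have "?v $ i = eval_mpoly (f i) u" if "i < n" for i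
        using that u a \<open>d \<le> n - 1\<close>
        by (auto simp: f_def \<rho>_def eval_mpoly_add eval_mpoly_mult)
      then have "eval_mpoly (subst_mpoly f p) u = eval_mpoly p ?v"
        by (rule eval_subst_mpoly[OF p_in])
      moreover have "?v \<in> S" using sub u by blast
      ultimately show "eval_mpoly (subst_mpoly f p) u = 0" using p_S by simp
    qed
    have "(\<Sum>m\<in>K. Poly_Mapping.single 0 (Poly_Mapping.lookup p m) *
        (\<Prod>i\<in>Poly_Mapping.keys m. (Poly_Mapping.single 0 (r i) * b i) ^ Poly_Mapping.lookup m i)) = 0"
      by (intro top_form_of_zero[of D] top[unfolded subst_zero])
    moreover have "(\<Prod>i\<in>Poly_Mapping.keys m. (Poly_Mapping.single 0 (r i) * b i) ^ Poly_Mapping.lookup m i) =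
        Poly_Mapping.single 0 (\<Prod>i\<in>{d..<n}. t i ^ Poly_Mapping.lookup m i) * B m" if "m \<in> K" for m
    proof -
      have "(\<Prod>i\<in>Poly_Mapping.keys m. (Poly_Mapping.single 0 (r i) * b i) ^ Poly_Mapping.lookup m i) =
          (\<Prod>i<n. (Poly_Mapping.single 0 (r i) * b i) ^ Poly_Mapping.lookup m i)"
        using keys_K[OF that] by (intro prod.mono_neutral_left) (auto simp: in_keys_iff)
      also have "\<dots> = Poly_Mapping.single 0 (\<Prod>i<n. r i ^ Poly_Mapping.lookup m i) * B m"
        by (simp add: B_def power_mult_distrib prod.distrib single_0_power single_0_prod)
      also have "(\<Prod>i<n. r i ^ Poly_Mapping.lookup m i) = (\<Prod>i\<in>{d..<n}. r i ^ Poly_Mapping.lookup m i)"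
        by (intro prod.mono_neutral_right) (auto simp: r_def)
      also have "\<dots> = (\<Prod>i\<in>{d..<n}. t i ^ Poly_Mapping.lookup m i)"
        by (intro prod.cong) (auto simp: r_def)
      finally show ?thesis .
    qed
    ultimately show ?thesis by (simp add: mult.assoc[symmetric] mult_single)
  qed

  \<comment> \<open>The monomials of highest weight that carry the same monomial in
    \<open>\<rho>\<close> as \<open>m0\<close>.\<close>
  define K0 where "K0 = {m \<in> K. \<forall>i\<in>{d..<n}. Poly_Mapping.lookup m i = Poly_Mapping.lookup m0 i}"
  have K0_zero: "(\<Sum>m\<in>K0. Poly_Mapping.single 0 (Poly_Mapping.lookup p m) * B m) = 0"
  proof (rule poly_mapping_eqI)
    fix u
    \<comment> \<open>At a fixed exponent \<open>u\<close>, \<open>top_zero\<close> is a scalar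
      identity in the entries of \<open>\<rho>\<close>, whose exponents are at most
      \<open>k \<le> q - 1\<close>.\<close>
    have "(\<Sum>m\<in>K0. Poly_Mapping.lookup p m * Poly_Mapping.lookup (B m) u) = 0"
      unfolding K0_def
    proof (rule sum_coeffs_eq_0_if_vanishing[OF _ \<open>finite K\<close>])
      fix m i assume "m \<in> K"
      then have "Poly_Mapping.lookup m i \<le> k"
        using keys_p M(3)[of m] lookup_le_monom_degree[of m i] by (auto simp: K_def)
      moreover have "k \<le> q - 1" unfolding k_def by simp
      ultimately show "Poly_Mapping.lookup m i < CARD('a)" using q_pos assms(1) by linarith
    next
      fix t :: "nat \<Rightarrow> 'a"
      show "(\<Sum>m\<in>K. Poly_Mapping.lookup p m * Poly_Mapping.lookup (B m) u *
          (\<Prod>i\<in>{d..<n}. t i ^ Poly_Mapping.lookup m i)) = 0"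
        using arg_cong[OF top_zero[of t], of "\<lambda>x. Poly_Mapping.lookup x u"]
        unfolding lookup_sum lookup_single_0_mult by (simp add: mult_ac)
    qed simp
    then show "Poly_Mapping.lookup (\<Sum>m\<in>K0. Poly_Mapping.single 0 (Poly_Mapping.lookup p m) * B m) u =
        Poly_Mapping.lookup 0 u"
      by (simp add: lookup_sum lookup_single_0_mult)
  qed
  \<comment> \<open>On \<open>K0\<close> the powers of the forms \<open>h\<close> are the same for
    all monomials, so \<open>H\<close> is a common factor and only the monomial \<open>low m\<close>
    in the first \<open>d\<close> variables varies.\<close>
  define H where "H = (\<Prod>i\<in>{d..<n}. b i ^ Poly_Mapping.lookup m0 i)"
  define low :: "(nat \<Rightarrow>\<^sub>0 nat) \<Rightarrow> nat \<Rightarrow>\<^sub>0 nat"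
    where "low = (\<lambda>m. \<Sum>i<d. Poly_Mapping.single i (Poly_Mapping.lookup m i))"
  have B_eq: "B m = Poly_Mapping.single (low m) 1 * H" if "m \<in> K0" for m
  proof -
    have split: "{..<n} = {..<d} \<union> {d..<n}" using \<open>d \<le> n - 1\<close> by auto
    have "B m = (\<Prod>i<d. b i ^ Poly_Mapping.lookup m i) * (\<Prod>i\<in>{d..<n}. b i ^ Poly_Mapping.lookup m i)"
      unfolding B_def split by (rule prod.union_disjoint) auto
    also have "(\<Prod>i\<in>{d..<n}. b i ^ Poly_Mapping.lookup m i) = H"
      using that unfolding H_def K0_def by (intro prod.cong) auto
    also have "(\<Prod>i<d. b i ^ Poly_Mapping.lookup m i) = (\<Prod>i<d. var i ^ Poly_Mapping.lookup m i)"
      by (intro prod.cong) (auto simp: b_def)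
    also have "\<dots> = Poly_Mapping.single (low m) 1"
      unfolding low_def by (rule prod_var_power)
    finally show ?thesis .
  qed
  have "(\<Sum>m\<in>K0. Poly_Mapping.single (low m) (Poly_Mapping.lookup p m)) * H =
      (\<Sum>m\<in>K0. Poly_Mapping.single 0 (Poly_Mapping.lookup p m) * B m)"
    unfolding sum_distrib_right
    by (intro sum.cong refl) (simp add: B_eq mult.assoc[symmetric] mult_single)
  with K0_zero have "(\<Sum>m\<in>K0. Poly_Mapping.single (low m) (Poly_Mapping.lookup p m)) * H = 0"
    by (rule trans[rotated])
  \<comment> \<open>The forms are nonzero by homogeneity and polynomials over a field have no zero
    divisors, so \<open>H\<close> can be cancelled.\<close>
  moreover have "H \<noteq> 0"
  proof -
    have "b i \<noteq> 0" if "i \<in> {d..<n}" for i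
      using h[of "i - d"] that diff_less_mono[of i n d] by (auto simp: b_def homogeneous_of_degree_def)
    then show ?thesis unfolding H_def by (subst prod_zero_iff) auto
  qed
  ultimately have "(\<Sum>m\<in>K0. Poly_Mapping.single (low m) (Poly_Mapping.lookup p m)) = 0"
    by simp
  from arg_cong[OF this, of "\<lambda>x. Poly_Mapping.lookup x (low m0)"]
  have "(\<Sum>m\<in>K0. Poly_Mapping.lookup p m when low m = low m0) = 0"
    by (simp add: lookup_sum lookup_single)
  \<comment> \<open>Within \<open>K0\<close> the remaining exponents are fixed, so distinct
    monomials have distinct \<open>low\<close> parts and the sum reduces to the term of
    \<open>m0\<close>.\<close>
  moreover have "low m = low m0 \<longleftrightarrow> m = m0" if "m \<in> K0" for m
  proof
    assume eq: "low m = low m0"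
    have look: "Poly_Mapping.lookup (low m) i = Poly_Mapping.lookup m i" if "i < d" for m i
      using that by (simp add: low_def lookup_sum lookup_single when_def)
    have "Poly_Mapping.lookup m i = Poly_Mapping.lookup m0 i" for i
    proof -
      consider "i < d" | "i \<in> {d..<n}" | "i \<notin> {..<n}" by fastforce
      then show ?thesis
      proof cases
        case 1
        then show ?thesis using look[of i m] look[of i m0] eq by simp
      next
        case 2
        then show ?thesis using that by (simp add: K0_def)
      next
        case 3
        then have "i \<notin> Poly_Mapping.keys m" "i \<notin> Poly_Mapping.keys m0"
          using keys_K[of m] keys_K[of m0] that m0 unfolding K0_def by (auto simp: K_def)
        then show ?thesis by (simp add: in_keys_iff)
      qed
    qed
    then show "m = m0" by (rule poly_mapping_eqI)
  qed simp
  moreover have "m0 \<in> K0" "finite K0" using m0 \<open>finite K\<close> by (auto simp: K0_def K_def)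
  ultimately have "Poly_Mapping.lookup p m0 = 0"
    by (simp add: when_def sum.delta' cong: sum.cong)
  with m0 show False by (simp add: in_keys_iff)
qed

end
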